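(* Let $m\ge 4$ be an integer, $0<a<1$ and $\mathcal{E}:=\{z\in\mathbb{C}^2:|z_1|+|z_2|<1\}$. Then the mapping $f:\mathbb{D}\to\mathcal{E}$, $$f(\lambda):=(a\lambda^{m-1},(1-a)\lambda^{m-1}),\quad\lambda\in\mathbb{D},$$ is an $m$-geodesic of $\mathcal{E}$ such that $\varphi(\lambda):=(f_1(\lambda)/\lambda^2,f_2(\lambda)/\lambda)$ is not an $(m-1)$-geodesic of $\mathcal{E}$.
   Context: $\mathbb{D}$ is the open unit disc in $\mathbb{C}$. A finite Blaschke product of degree $k\in\{0,1,2,\ldots\}$ is a function $\zeta\prod_{j=1}^k m_{\alpha_j}$ with $|\zeta|=1$, $\alpha_j\in\mathbb{D}$, $m_\alpha(\lambda)=\frac{\lambda-\alpha}{1-\overline{\alpha}\lambda}$. For an integer $l\ge 2$, a holomorphic mapping $f:\mathbb{D}\to D$ into a domain $D\subset\mathbb{C}^n$ is an $l$-geodesic if there is a holomorphic $F:D\to\mathbb{D}$ such that $F\circ f$ is a non-constant Blaschke product of degree at most $l-1$. *)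

theory Defs
  imports "HOL-Complex_Analysis.Complex_Analysis"
begin

no_notation fps_nth (infixl "$" 75)

definition blaschke_factor :: "complex \<Rightarrow> complex \<Rightarrow> complex" where
  "blaschke_factor \<alpha> z = (z - \<alpha>) / (1 - cnj \<alpha> * z)"

lemma blaschke_factor_eq_Moebius_function: "blaschke_factor \<alpha> = Moebius_function 0 \<alpha>"
  by (auto simp: blaschke_factor_def Moebius_function_def fun_eq_iff)

text \<open>Only the values of \<open>B\<close> on the open unit disc matter.\<close>

definition is_blaschke_product :: "nat \<Rightarrow> (complex \<Rightarrow> complex) \<Rightarrow> bool" where
  "is_blaschke_product k B \<longleftrightarrow>
     (\<exists>\<zeta> \<alpha>. norm \<zeta> = 1 \<and> (\<forall>j<k. \<alpha> j \<in> ball 0 1) \<and>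
        (\<forall>z\<in>ball 0 1. B z = \<zeta> * (\<Prod>j<k. blaschke_factor (\<alpha> j) z)))"

text \<open>
  Holomorphy of functions of several complex variables on an open set: total differentiability
  with a complex linear derivative.
\<close>

definition holomorphic_function_on :: "(complex ^ 'n \<Rightarrow> complex) \<Rightarrow> (complex ^ 'n) set \<Rightarrow> bool" where
  "holomorphic_function_on F D \<longleftrightarrow>
     (\<forall>x\<in>D. \<exists>F'. (F has_derivative F') (at x) \<and> (\<forall>c v. F' (c *s v) = c * F' v))"

definition holomorphic_disc_in :: "(complex \<Rightarrow> complex ^ 'n) \<Rightarrow> (complex ^ 'n) set \<Rightarrow> bool" where
  "holomorphic_disc_in f D \<longleftrightarrow>
     (\<forall>i. (\<lambda>z. f z $ i) holomorphic_on ball 0 1) \<and> f ` ball 0 1 \<subseteq> D"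

text \<open>The notion is meant for \<open>l \<ge> 2\<close> and domains (nonempty connected open sets) \<open>D\<close>.\<close>

definition l_geodesic :: "nat \<Rightarrow> (complex ^ 'n) set \<Rightarrow> (complex \<Rightarrow> complex ^ 'n) \<Rightarrow> bool" where
  "l_geodesic l D f \<longleftrightarrow>
     holomorphic_disc_in f D \<and>
     (\<exists>F. holomorphic_function_on F D \<and> F ` D \<subseteq> ball 0 1 \<and>
          \<not> (F \<circ> f) constant_on ball 0 1 \<and>
          (\<exists>k\<le>l - 1. is_blaschke_product k (F \<circ> f)))"

definition ellipsoid :: "(complex ^ 2) set" where
  "ellipsoid = {z. norm (z $ 1) + norm (z $ 2) < 1}"

lemma ellipsoid_domain: "open ellipsoid" "connected ellipsoid" "ellipsoid \<noteq> {}"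
proof -
  show "open ellipsoid"
    unfolding ellipsoid_def by (intro open_Collect_less continuous_intros)
  have "convex ellipsoid"
  proof (rule convexI)
    fix x y :: "complex ^ 2" and u v :: real
    assume xy: "x \<in> ellipsoid" "y \<in> ellipsoid" and uv: "0 \<le> u" "0 \<le> v" "u + v = 1"
    have "norm ((u *\<^sub>R x + v *\<^sub>R y) $ i) \<le> u * norm (x $ i) + v * norm (y $ i)" for i
      using norm_triangle_ineq[of "u *\<^sub>R x $ i" "v *\<^sub>R y $ i"] uv by simp
    from add_mono[OF this[of 1] this[of 2]]
    have "norm ((u *\<^sub>R x + v *\<^sub>R y) $ 1) + norm ((u *\<^sub>R x + v *\<^sub>R y) $ 2)
        \<le> u * (norm (x $ 1) + norm (x $ 2)) + v * (norm (y $ 1) + norm (y $ 2))"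
      by (simp add: algebra_simps)
    also have "\<dots> < 1"
      using xy uv by (intro convex_bound_lt) (auto simp: ellipsoid_def)
    finally show "u *\<^sub>R x + v *\<^sub>R y \<in> ellipsoid"
      by (simp add: ellipsoid_def)
  qed
  then show "connected ellipsoid" by (rule convex_connected)
  show "ellipsoid \<noteq> {}"
    by (auto simp: ellipsoid_def intro: exI[of _ 0])
qed

text \<open>
  In the quotients \<open>f\<^sub>1(z) / z\<^sup>2\<close> and \<open>f\<^sub>2(z) / z\<close> the singularity at \<open>0\<close> is to be removed. Since
  \<open>m \<ge> 4\<close>, the removed value is \<open>0\<close>, which is also the value of the HOL term, because \<open>x / 0 = 0\<close>.
  So the quotients can be written literally.
\<close>

lemma quotient_disc_eq:
  fixes a :: real and z :: complex
  assumes "m \<ge> (4::nat)"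
  shows "of_real a * z ^ (m - 1) / z ^ 2 = of_real a * z ^ (m - 3)"
    and "of_real (1 - a) * z ^ (m - 1) / z = of_real (1 - a) * z ^ (m - 2)"
proof -
  have exps: "m - 1 = (m - 3) + 2" "m - 1 = (m - 2) + 1"
    using assms by linarith+
  have "z ^ (m - 1) = z ^ (m - 3) * z ^ 2"
    by (subst exps(1), rule power_add)
  then show "of_real a * z ^ (m - 1) / z ^ 2 = of_real a * z ^ (m - 3)"
    using assms by (cases "z = 0") auto
  have "z ^ (m - 1) = z ^ (m - 2) * z ^ 1"
    by (subst exps(2), rule power_add)
  then show "of_real (1 - a) * z ^ (m - 1) / z = of_real (1 - a) * z ^ (m - 2)"
    using assms by (cases "z = 0") auto
qed

lemma holomorphic_quotient_disc:
  fixes m :: nat and a :: real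
  assumes "m \<ge> 4" "0 < a" "a < 1"
  shows "holomorphic_disc_in (\<lambda>z. vector [of_real a * z ^ (m - 1) / z ^ 2,
           of_real (1 - a) * z ^ (m - 1) / z] :: complex ^ 2) ellipsoid"
  unfolding quotient_disc_eq[OF assms(1)] holomorphic_disc_in_def
proof (intro conjI allI image_subsetI)
  fix i :: 2
  show "(\<lambda>z. (vector [of_real a * z ^ (m - 3), of_real (1 - a) * z ^ (m - 2)] :: complex ^ 2) $ i)
          holomorphic_on ball 0 1"
    using exhaust_2[of i] by (auto intro!: holomorphic_intros simp: vector_2)
next
  fix z :: complex assume "z \<in> ball 0 1"
  then have z: "norm z < 1" by simp
  have "norm z ^ (m - 3) < 1"
    using z assms by (intro power_less_one_iff[THEN iffD2]) auto
  then have "a * norm z ^ (m - 3) < a"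
    using assms by simp
  moreover have "(1 - a) * norm z ^ (m - 2) \<le> 1 - a"
    using z assms by (simp add: mult_left_le power_le_one)
  moreover have "norm (of_real a * z ^ (m - 3)) = a * norm z ^ (m - 3)"
    "norm (of_real (1 - a) * z ^ (m - 2)) = (1 - a) * norm z ^ (m - 2)"
    using assms by (simp_all only: norm_mult norm_power norm_of_real abs_of_pos diff_gt_0_iff_gt)
  ultimately show "(vector [of_real a * z ^ (m - 3), of_real (1 - a) * z ^ (m - 2)] :: complex ^ 2)
      \<in> ellipsoid"
    unfolding ellipsoid_def mem_Collect_eq vector_2 by linarith
qed

end

theory Submission imports Defs begin

text \<open>
  Composing \<open>f\<close> with the coordinate sum gives \<open>z\<^sup>m\<^sup>-\<^sup>1\<close>. For the second claim
  write \<open>p = m - 3\<close>, so that \<open>\<phi> z = (a z\<^sup>p, (1 - a) z\<^sup>p\<^sup>+\<^sup>1)\<close>, and suppose that \<open>F \<circ> \<phi>\<close> is a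
  non-constant Blaschke product of degree at most \<open>p + 1\<close>. After composing with a disc automorphism,
  \<open>G\<close> maps the ellipsoid to the disc, \<open>G 0 = 0\<close> and \<open>G (\<phi> z) = O(z\<^sup>p)\<close>. Since the degree is at most
  \<open>p + 1\<close>, this leaves \<open>G (\<phi> z) = z\<^sup>p Q z\<close> with \<open>Q\<close> a Blaschke product of degree at most one, so
  \<open>\<bar>Q' 0\<bar> = 1 - \<bar>Q 0\<bar>\<^sup>2\<close>. Write \<open>G (s, 0) = s u(s)\<close>. The Schwarz-Pick lemma on the slices
  \<open>w \<mapsto> G (s, w)\<close> gives \<open>Q 0 = a u(0)\<close> and, to first order,
  \<open>\<bar>Q z - a u(a z\<^sup>p)\<bar> \<le> (1 - a) \<bar>z\<bar>\<close>, while \<open>\<bar>u(s) - u(0)\<bar> \<le> (1 - \<bar>u(0)\<bar>\<^sup>2) \<bar>s\<bar>\<close> to first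
  order. Therefore \<open>1 - a\<^sup>2 \<bar>u(0)\<bar>\<^sup>2 \<le> a\<^sup>2 (1 - \<bar>u(0)\<bar>\<^sup>2) + (1 - a)\<close>, that is \<open>a \<le> a\<^sup>2\<close>,
  contradicting \<open>0 < a < 1\<close>.
\<close>

section \<open>Consequences of the Schwarz lemma on the unit disc\<close>

text \<open>\<open>u\<close> is \<open>f z / z\<close> with the singularity at 0 filled by
  \<open>deriv f 0\<close>; the two parts of the Schwarz lemma bound it off 0 and at 0. Rotations
  show that the bound 1 can be attained.\<close>

lemma Schwarz_quotient:
  assumes holf: "f holomorphic_on ball 0 1" and f0: "f 0 = 0"
    and no: "\<And>z. norm z < 1 \<Longrightarrow> norm (f z) < 1"
  obtains u where "u holomorphic_on ball 0 1"
    "\<And>z. norm z < 1 \<Longrightarrow> f z = z * u z" "\<And>z. norm z < 1 \<Longrightarrow> norm (u z) \<le> 1"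
proof -
  obtain u where holu: "u holomorphic_on ball 0 1"
    and fz: "\<And>z. norm z < 1 \<Longrightarrow> f z = z * u z" and df0: "deriv f 0 = u 0"
    by (rule Schwarz3[OF holf f0]) auto
  have "norm (u z) \<le> 1" if z: "norm z < 1" for z
  proof (cases "z = 0")
    case True
    then show ?thesis
      using Schwarz_Lemma(2)[OF holf f0 no, of 0] df0 by simp
  next
    case False
    then show ?thesis
      using Schwarz_Lemma(1)[OF holf f0 no z] fz[OF z] by (simp add: norm_mult)
  qed
  then show ?thesis
    using that[OF holu fz] by blast
qed

text \<open>The Schwarz lemma for \<open>f\<close> followed by the automorphism that sends
  \<open>f 0\<close> to 0. With the denominator cleared, the estimate also covers unimodular
  constants, which can occur as the \<open>u\<close> of \<open>Schwarz_quotient\<close>.\<close>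

lemma Schwarz_Pick_at_0:
  assumes holf: "f holomorphic_on ball 0 1"
    and no: "\<And>z. norm z < 1 \<Longrightarrow> norm (f z) \<le> 1" and z: "norm z < 1"
  shows "norm (f z - f 0) \<le> norm z * norm (1 - cnj (f 0) * f z)"
proof (cases "\<exists>w\<in>ball 0 1. norm (f w) = 1")
  \<comment> \<open>By the maximum modulus principle \<open>f\<close> is constant here, so the
    left-hand side is 0.\<close>
  case True
  then obtain w where w: "w \<in> ball 0 1" "norm (f w) = 1"
    by blast
  have "f constant_on ball 0 1"
    by (rule maximum_modulus_principle[OF holf _ _ open_ball order_refl w(1)])
       (use w no in auto)
  then have "f z = f 0"
    using z by (metis constant_on_def mem_ball_0 norm_zero zero_less_one)
  then show ?thesis
    by simp
next
  case False
  then have no': "norm (f w) < 1" if "norm w < 1" for w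
    using no[OF that] that by (fastforce simp: order_less_le)
  let ?M = "Moebius_function 0 (f 0)"
  have "norm ((?M \<circ> f) z) \<le> norm z"
  proof (rule Schwarz_Lemma(1)[OF _ _ _ z])
    show "?M \<circ> f holomorphic_on ball 0 1"
      by (rule holomorphic_on_compose_gen[OF holf Moebius_function_holomorphic])
         (use no' in auto)
    show "(?M \<circ> f) 0 = 0"
      by (simp add: Moebius_function_eq_zero)
    show "norm ((?M \<circ> f) w) < 1" if "norm w < 1" for w
      using Moebius_function_norm_lt_1[OF no'[of 0] no'[OF that]] by simp
  qed
  moreover have "norm (cnj (f 0) * f z) < 1"
    using mult_strict_mono'[OF no'[of 0] no'[OF z]] by (simp add: norm_mult)
  then have "1 - cnj (f 0) * f z \<noteq> 0"
    by auto
  ultimately show ?thesis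
    by (simp add: Moebius_function_simple norm_divide divide_le_eq)
qed

section \<open>Blaschke products that take a value to high order at 0\<close>

text \<open>The bound forces \<open>poly p\<close> to tend to 0, so the constant coefficient
  vanishes; cancelling one factor \<open>z\<close> lowers \<open>n\<close> by one.\<close>

lemma poly_bigo_imp_monom_dvd:
  fixes p :: "complex poly"
  assumes "poly p \<in> O[at 0](\<lambda>z. z ^ n)"
  shows "monom 1 n dvd p"
  using assms
proof (induction n arbitrary: p)
  case 0
  show ?case by (simp flip: one_pCons add: monom_0)
next
  case (Suc n)
  obtain a p' where p: "p = pCons a p'"
    by (cases p)
  have "(\<lambda>z::complex. z ^ Suc n) \<midarrow>0\<rightarrow> 0"
    by (auto intro!: tendsto_eq_intros)
  moreover obtain c where "eventually (\<lambda>z. norm (poly p z) \<le> c * norm (z ^ Suc n)) (at 0)"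
    using Suc.prems by (rule landau_o.bigE)
  ultimately have "poly p \<midarrow>0\<rightarrow> 0"
    by (intro Lim_null_comparison[of "poly p" "\<lambda>z. c * norm (z ^ Suc n)"])
       (auto intro!: tendsto_mult_right_zero tendsto_norm_zero)
  moreover have "poly p \<midarrow>0\<rightarrow> poly p 0"
    using poly_isCont[of 0 p] by (simp add: isCont_def)
  ultimately have "a = 0"
    using p by (auto dest: LIM_unique)
  with p have "(\<lambda>z. z * poly p' z) \<in> O[at 0](\<lambda>z. z * z ^ n)"
    using Suc.prems by (simp add: fun_eq_iff)
  then have "poly p' \<in> O[at 0](\<lambda>z. z ^ n)"
    by (subst (asm) landau_o.big.mult_cancel_left) (auto simp: eventually_at intro!: exI[of _ 1])
  from Suc.IH[OF this] obtain s where "p' = monom 1 n * s"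
    by blast
  then have "p = monom 1 (Suc n) * s"
    using p \<open>a = 0\<close> by (simp add: monom_Suc)
  then show ?case
    by simp
qed

text \<open>
  The right-hand side is \<open>z\<^sup>n\<close> times a Blaschke product of degree one, or of degree zero when
  \<open>\<bar>q\<bar> = 1\<close>.
\<close>

lemma blaschke_product_recentred:
  assumes B: "is_blaschke_product k B" and k: "k \<le> Suc n"
    and lt1: "\<And>z. norm z < 1 \<Longrightarrow> norm (B z) < 1" and \<beta>: "norm \<beta> < 1"
    and nonconst: "\<not> B constant_on ball 0 1"
    and bigo: "(\<lambda>z. B z - \<beta>) \<in> O[at 0](\<lambda>z. z ^ n)"
  obtains q \<eta> where "norm \<eta> = 1"
    "\<And>z. norm z < 1 \<Longrightarrow> 1 + cnj q * \<eta> * z \<noteq> 0"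
    "\<And>z. norm z < 1 \<Longrightarrow> (B z - \<beta>) / (1 - cnj \<beta> * B z) = z ^ n * ((q + \<eta> * z) / (1 + cnj q * \<eta> * z))"
proof -
  obtain \<zeta> \<alpha> where \<zeta>: "norm \<zeta> = 1" and \<alpha>: "\<And>j. j < k \<Longrightarrow> norm (\<alpha> j) < 1"
    and Bz: "\<And>z. norm z < 1 \<Longrightarrow> B z = \<zeta> * (\<Prod>j<k. blaschke_factor (\<alpha> j) z)"
    using B unfolding is_blaschke_product_def mem_ball_0 Ball_def by blast
  have \<zeta>0: "\<zeta> \<noteq> 0" and \<zeta>\<zeta>: "\<zeta> * cnj \<zeta> = 1"
    using \<zeta> by (auto simp: complex_norm_square[symmetric])
  \<comment> \<open>On the disc \<open>B\<close> is \<open>P / Q\<close>, and the automorphism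
    sending \<open>\<beta>\<close> to 0 turns it into \<open>R / S\<close>.\<close>
  define P where "P = smult \<zeta> (\<Prod>j<k. [:- \<alpha> j, 1:])"
  define Q where "Q = (\<Prod>j<k. [:1, - cnj (\<alpha> j):])"
  define R where "R = P - smult \<beta> Q"
  define S where "S = Q - smult (cnj \<beta>) P"
  have Q0: "poly Q z \<noteq> 0" if "norm z < 1" for z
  proof -
    have "1 - cnj (\<alpha> j) * z \<noteq> 0" if "j < k" for j
    proof -
      have "norm (cnj (\<alpha> j) * z) < 1"
        using mult_strict_mono'[OF \<alpha>[OF that] \<open>norm z < 1\<close>] by (simp add: norm_mult)
      then show ?thesis by auto
    qed
    then show ?thesis
      by (auto simp: Q_def poly_prod algebra_simps)
  qed
  have BQ: "B z * poly Q z = poly P z" if "norm z < 1" for z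
    using Q0[OF that]
    by (simp add: Bz[OF that] P_def Q_def poly_prod blaschke_factor_def prod_dividef algebra_simps)
  have R: "poly R z = poly Q z * (B z - \<beta>)" if "norm z < 1" for z
    using BQ[OF that] by (simp add: R_def algebra_simps)
  have S: "poly S z = poly Q z * (1 - cnj \<beta> * B z)" if "norm z < 1" for z
    using BQ[OF that] by (simp add: S_def algebra_simps)
  have S0: "poly S z \<noteq> 0" if "norm z < 1" for z
  proof -
    have "norm (cnj \<beta> * B z) < 1"
      using mult_strict_mono'[OF \<beta> lt1[OF that]] by (simp add: norm_mult)
    then show ?thesis
      using S[OF that] Q0[OF that] by auto
  qed
  have quot: "(B z - \<beta>) / (1 - cnj \<beta> * B z) = poly R z / poly S z" if "norm z < 1" for z
    using R[OF that] S[OF that] Q0[OF that] by simp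

  text \<open>
    Reflection \<open>p \<mapsto> z\<^sup>k cnj (p (1 / cnj z))\<close> in the unit circle swaps \<open>P\<close> and \<open>Q\<close> up to the factor
    \<open>\<zeta>\<close>, hence \<open>R\<close> and \<open>S\<close>; so the denominator \<open>S\<close> is determined by the numerator \<open>R\<close>.
  \<close>
  have prods: "(\<Prod>j<k. 1 - cnj (\<alpha> j) * z) = z ^ k * cnj (\<Prod>j<k. 1 / cnj z - \<alpha> j)"
    "(\<Prod>j<k. z - \<alpha> j) = z ^ k * cnj (\<Prod>j<k. 1 - cnj (\<alpha> j) * (1 / cnj z))" if "z \<noteq> 0" for z
  proof -
    have "z ^ k = (\<Prod>j<k. z)" by simp
    then show "(\<Prod>j<k. 1 - cnj (\<alpha> j) * z) = z ^ k * cnj (\<Prod>j<k. 1 / cnj z - \<alpha> j)"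
      "(\<Prod>j<k. z - \<alpha> j) = z ^ k * cnj (\<Prod>j<k. 1 - cnj (\<alpha> j) * (1 / cnj z))"
      using that by (auto simp: prod.distrib[symmetric] field_simps simp del: prod_constant intro!: prod.cong)
  qed
  have refl_P: "poly Q z = \<zeta> * z ^ k * cnj (poly P (1 / cnj z))"
    and refl_Q: "poly P z = \<zeta> * z ^ k * cnj (poly Q (1 / cnj z))" if "z \<noteq> 0" for z
    using prods[OF that] \<zeta>\<zeta> by (simp_all add: P_def Q_def poly_prod algebra_simps)
  have refl: "poly S z = \<zeta> * z ^ k * cnj (poly R (1 / cnj z))" if "z \<noteq> 0" for z
    unfolding S_def R_def by (simp add: refl_P[OF that] refl_Q[OF that] algebra_simps)

  have "degree (\<Prod>j<k. [:- \<alpha> j, 1:]) \<le> k" "degree Q \<le> k"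
    unfolding Q_def
    by (rule order_trans[OF degree_prod_sum_le], simp, rule order_trans[OF sum_bounded_above[of _ _ 1]], simp_all)+
  then have degR: "degree R \<le> k"
    unfolding R_def P_def by (intro degree_diff_le order_trans[OF degree_smult_le])
  have R0: "R \<noteq> 0"
  proof
    assume "R = 0"
    then have "B z = \<beta>" if "norm z < 1" for z
      using R[OF that] Q0[OF that] by simp
    then show False
      using nonconst by (auto simp: constant_on_def)
  qed
  have near: "eventually (\<lambda>z::complex. norm z < 1) (at 0)"
    by (auto simp: eventually_at intro!: exI[of _ 1])
  have "poly Q \<in> O[at 0](\<lambda>_. 1)"
    using poly_isCont[of 0 Q] by (intro bigoI_tendsto[where c = "poly Q 0"]) (auto simp: isCont_def)
  then have "(\<lambda>z. poly Q z * (B z - \<beta>)) \<in> O[at 0](\<lambda>z. 1 * z ^ n)"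
    by (rule landau_o.big.mult[OF _ bigo])
  then have "poly R \<in> O[at 0](\<lambda>z. z ^ n)"
    using near R by (subst landau_o.big.in_cong[of _ "\<lambda>z. poly Q z * (B z - \<beta>)"])
      (auto elim!: eventually_mono)
  then have "monom 1 n dvd R"
    by (rule poly_bigo_imp_monom_dvd)
  then obtain T where T: "R = monom 1 n * T"
    by blast
  with R0 have "T \<noteq> 0" by auto
  then have degT: "n + degree T \<le> k"
    using degR T by (simp add: degree_mult_eq degree_monom_eq)
  have RT: "poly R z = z ^ n * poly T z" for z
    using T by (simp add: poly_monom)
  \<comment> \<open>The factor \<open>z ^ n\<close> of \<open>R\<close> reflects to
    \<open>1 / z ^ n\<close>, which lowers the power of \<open>z\<close> from \<open>k\<close> to
    \<open>k - n\<close>.\<close>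
  have refl': "poly S z = \<zeta> * z ^ (k - n) * cnj (poly T (1 / cnj z))" if "z \<noteq> 0" for z
  proof -
    have "z ^ k = z ^ (k - n) * z ^ n"
      using degT by (simp flip: power_add)
    then show ?thesis
      using that by (simp add: refl[OF that] RT power_one_over)
  qed
  \<comment> \<open>\<open>R\<close> is divisible by \<open>z ^ n\<close> and has degree at most
    \<open>k \<le> Suc n\<close>, so \<open>T\<close> has degree at most \<open>k - n\<close>, which
    is 0 or 1.\<close>
  consider "k = n" | "k = Suc n"
    using degT k by linarith
  then show ?thesis
  proof cases
    case 1
    with degT have "degree T = 0" by simp
    then obtain c where c: "T = [:c:]"
      by (rule degree_eq_zeroE)
    with \<open>T \<noteq> 0\<close> have c0: "c \<noteq> 0" by simp
    \<comment> \<open>\<open>refl'\<close> says nothing at \<open>z = 0\<close>. The extra factor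
      \<open>z\<close> makes both sides vanish there, so the polynomials agree everywhere and the
      factor can be cancelled.\<close>
    have "poly (S * [:0, 1:]) z = poly ([:\<zeta> * cnj c:] * [:0, 1:]) z" for z
      using refl'[of z] 1 c by (cases "z = 0") auto
    then have "S * [:0, 1:] = [:\<zeta> * cnj c:] * [:0, 1:]"
      by (subst poly_eq_poly_eq_iff[symmetric]) (rule ext)
    then have "S = [:\<zeta> * cnj c:]"
      by (subst (asm) mult_cancel_right) simp
    then have Sc: "poly S z = \<zeta> * cnj c" for z
      by simp
    \<comment> \<open>The quotient is the unimodular constant \<open>?q\<close> times
      \<open>z ^ n\<close>. Taking \<open>\<eta> = q\<close> fits it into the required form, since
      \<open>(q + q * z) / (1 + z)\<close> collapses to \<open>q\<close>.\<close>
    let ?q = "c / (\<zeta> * cnj c)"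
    have q1: "norm ?q = 1"
      using \<zeta> c0 by (simp add: norm_divide norm_mult)
    then have qq: "cnj ?q * ?q = 1"
      by (metis complex_norm_square mult.commute of_real_1 power_one)
    show ?thesis
    proof (rule that[of ?q ?q])
      fix z :: complex assume z: "norm z < 1"
      have z1: "1 + z \<noteq> 0"
        using z by (metis add.commute add_eq_0_iff norm_minus_cancel norm_one order_less_irrefl)
      then show "1 + cnj ?q * ?q * z \<noteq> 0"
        unfolding qq by simp
      have "(?q + ?q * z) / (1 + cnj ?q * ?q * z) = ?q"
        unfolding qq using z1 by (simp add: divide_eq_eq ring_distribs)
      then show "(B z - \<beta>) / (1 - cnj \<beta> * B z) =
          z ^ n * ((?q + ?q * z) / (1 + cnj ?q * ?q * z))"
        by (simp only: quot[OF z] RT Sc c) simp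
    qed (fact q1)
  next
    case 2
    with degT have "degree T \<le> 1" by simp
    then have "T = [:coeff T 0, coeff T 1:]"
      by (intro poly_eqI) (auto simp: coeff_pCons coeff_eq_0 split: nat.split)
    then obtain c d where cd: "T = [:c, d:]"
      by blast
    have "poly (S * [:0, 1:]) z = poly ([:\<zeta> * cnj d, \<zeta> * cnj c:] * [:0, 1:]) z" for z
      using refl'[of z] 2 cd by (cases "z = 0") (auto simp: field_simps)
    then have "S * [:0, 1:] = [:\<zeta> * cnj d, \<zeta> * cnj c:] * [:0, 1:]"
      by (subst poly_eq_poly_eq_iff[symmetric]) (rule ext)
    then have "S = [:\<zeta> * cnj d, \<zeta> * cnj c:]"
      by (subst (asm) mult_cancel_right) simp
    then have Scd: "poly S z = \<zeta> * (cnj d + cnj c * z)" for z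
      by (simp add: algebra_simps)
    with S0[of 0] have d0: "d \<noteq> 0" by auto
    \<comment> \<open>Numerator and denominator of
      \<open>(c + d * z) / (\<zeta> * (cnj d + cnj c * z))\<close> are divided by
      \<open>\<zeta> * cnj d\<close>, so that the denominator has constant term 1.\<close>
    let ?q = "c / (\<zeta> * cnj d)" and ?\<eta> = "d / (\<zeta> * cnj d)"
    have "cnj ?q * ?\<eta> = cnj c / cnj d"
      using d0 \<zeta>0 \<zeta>\<zeta> by (simp add: field_simps)
    then have den: "1 + cnj ?q * ?\<eta> * z = poly S z / (\<zeta> * cnj d)" for z
      using d0 \<zeta>0 by (simp add: Scd field_simps)
    show ?thesis
    proof (rule that[of ?\<eta> ?q])
      show "norm ?\<eta> = 1"
        using d0 \<zeta> by (simp add: norm_divide norm_mult)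
      fix z :: complex assume z: "norm z < 1"
      show "1 + cnj ?q * ?\<eta> * z \<noteq> 0"
        unfolding den using S0[OF z] d0 \<zeta>0 by simp
      have "?q + ?\<eta> * z = poly T z / (\<zeta> * cnj d)"
        by (simp add: cd add_divide_distrib mult.commute)
      then show "(B z - \<beta>) / (1 - cnj \<beta> * B z) =
          z ^ n * ((?q + ?\<eta> * z) / (1 + cnj ?q * ?\<eta> * z))"
        unfolding den using d0 \<zeta>0 S0[OF z] by (simp add: quot[OF z] RT)
    qed
  qed
qed


section \<open>Schwarz-Pick estimates on slices of the ellipsoid\<close>

text \<open>Rescaling to the unit disc. General radii are needed because the slice of the ellipsoid
  over \<open>s\<close> is a disc of radius \<open>1 - norm s\<close>.\<close>

lemma Schwarz_Pick_ball_at_0: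
  assumes holf: "f holomorphic_on ball 0 r"
    and no: "\<And>z. norm z < r \<Longrightarrow> norm (f z) \<le> 1" and z: "norm z < r"
  shows "norm (f z - f 0) \<le> norm z / r * norm (1 - cnj (f 0) * f z)"
proof -
  have r: "r > 0"
    using z norm_ge_zero[of z] by linarith
  let ?g = "\<lambda>t. f (of_real r * t)"
  have in_ball: "norm (of_real r * t) < r" if "norm t < 1" for t :: complex
    using that r by (simp add: norm_mult)
  have "?g holomorphic_on ball 0 1"
    by (rule holomorphic_on_compose_gen[OF _ holf, unfolded o_def])
       (use in_ball in \<open>auto intro!: holomorphic_intros\<close>)
  moreover have "norm (z / of_real r) < 1"
    using z r by (simp add: norm_divide)
  ultimately show ?thesis
    using Schwarz_Pick_at_0[of ?g "z / of_real r"] no[OF in_ball] r by (simp add: norm_divide)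
qed

lemma norm_ellipsoid_disc:
  fixes z :: complex
  assumes a: "0 < a" "a < 1" and p: "p \<ge> (1::nat)" and z: "norm z < 1"
  shows "norm (of_real a * z ^ p) = a * norm z ^ p" "a * norm z ^ p \<le> a"
    "norm (of_real (1 - a) * z ^ Suc p) = (1 - a) * norm z ^ Suc p"
    "a * norm z ^ p + (1 - a) * norm z ^ Suc p < 1" "norm (of_real a * z ^ p) < 1"
proof -
  show norm_fst: "norm (of_real a * z ^ p) = a * norm z ^ p"
    and "norm (of_real (1 - a) * z ^ Suc p) = (1 - a) * norm z ^ Suc p"
    using a by (simp_all only: norm_mult norm_power norm_of_real)
  have "norm z ^ p < 1"
    using z p by (intro power_less_one_iff[THEN iffD2]) auto
  moreover have "norm z ^ Suc p \<le> 1"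
    using z by (intro power_le_one) auto
  ultimately have "a * norm z ^ p < a" "(1 - a) * norm z ^ Suc p \<le> 1 - a"
    using a by (simp_all add: mult_left_le)
  then show "a * norm z ^ p \<le> a" "a * norm z ^ p + (1 - a) * norm z ^ Suc p < 1"
      "norm (of_real a * z ^ p) < 1"
    unfolding norm_fst using a by linarith+
qed

text \<open>Schwarz-Pick on the slice over \<open>a * z ^ p\<close>. Moving from its centre to the
  point of the disc changes \<open>G\<close> only by order \<open>Suc p\<close> in
  \<open>z\<close>.\<close>

lemma norm_diff_slice_le:
  fixes G :: "complex \<Rightarrow> complex \<Rightarrow> complex"
  assumes a: "0 < a" "a < 1" and p: "p \<ge> 1"
    and hol: "\<And>s. norm s < 1 \<Longrightarrow> G s holomorphic_on ball 0 (1 - norm s)"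
    and lt1: "\<And>s w. norm s + norm w < 1 \<Longrightarrow> norm (G s w) < 1"
    and z: "norm z < 1"
  defines "x \<equiv> G (of_real a * z ^ p) 0" and "y \<equiv> G (of_real a * z ^ p) (of_real (1 - a) * z ^ Suc p)"
  shows "norm (y - x) \<le> (1 - a) * norm z ^ Suc p / (1 - a * norm z ^ p) * norm (1 - cnj x * y)"
proof -
  note n = norm_ellipsoid_disc[OF a p z]
  have "norm (of_real a * z ^ p) < 1"
    by (fact n(5))
  moreover have "norm (of_real (1 - a) * z ^ Suc p) < 1 - norm (of_real a * z ^ p)"
    unfolding n(1,3) using n(4) by linarith
  moreover have "norm (G (of_real a * z ^ p) w) \<le> 1" if "norm w < 1 - norm (of_real a * z ^ p)" for w
    using lt1[of "of_real a * z ^ p" w] that by linarith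
  ultimately have "norm (y - x) \<le> norm (of_real (1 - a) * z ^ Suc p) / (1 - norm (of_real a * z ^ p))
      * norm (1 - cnj x * y)"
    unfolding x_def y_def by (intro Schwarz_Pick_ball_at_0 hol)
  then show ?thesis
    unfolding n(1,3) .
qed

text \<open>The path from the origin to the point of the disc has two legs. The Schwarz lemma along
  the first axis costs \<open>norm z ^ p\<close>, and the move inside the slice costs at most twice
  that; hence the constant 3.\<close>

lemma slice_bigo:
  fixes G :: "complex \<Rightarrow> complex \<Rightarrow> complex"
  assumes a: "0 < a" "a < 1" and p: "p \<ge> 1"
    and hol0: "(\<lambda>s. G s 0) holomorphic_on ball 0 1" and G0: "G 0 0 = 0"
    and hol: "\<And>s. norm s < 1 \<Longrightarrow> G s holomorphic_on ball 0 (1 - norm s)"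
    and lt1: "\<And>s w. norm s + norm w < 1 \<Longrightarrow> norm (G s w) < 1"
  shows "(\<lambda>z. G (of_real a * z ^ p) (of_real (1 - a) * z ^ Suc p)) \<in> O[at 0](\<lambda>z. z ^ p)"
proof (rule landau_o.bigI[where c = 3])
  have "norm (G (of_real a * z ^ p) (of_real (1 - a) * z ^ Suc p)) \<le> 3 * norm (z ^ p)"
    if z: "norm z < 1" for z
  proof -
    note n = norm_ellipsoid_disc[OF a p z]
    define x where "x = G (of_real a * z ^ p) 0"
    define y where "y = G (of_real a * z ^ p) (of_real (1 - a) * z ^ Suc p)"
    have "norm (y - x) \<le> (1 - a) * norm z ^ Suc p / (1 - a * norm z ^ p) * norm (1 - cnj x * y)"
      unfolding x_def y_def by (rule norm_diff_slice_le[OF a p hol lt1 z])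
    also have "\<dots> \<le> norm z ^ p * 2"
    proof (rule mult_mono)
      have "norm z ^ Suc p * (1 - a) \<le> norm z ^ Suc p * (1 - a * norm z ^ p)"
        using n(2) by (intro mult_left_mono) auto
      moreover have "0 < 1 - a * norm z ^ p"
        using n(2) a by linarith
      ultimately have "(1 - a) * norm z ^ Suc p / (1 - a * norm z ^ p) \<le> norm z ^ Suc p"
        by (simp only: pos_divide_le_eq mult.commute[of "1 - a"])
      also have "\<dots> \<le> norm z ^ p"
        using z by (intro power_decreasing) auto
      finally show "(1 - a) * norm z ^ Suc p / (1 - a * norm z ^ p) \<le> norm z ^ p" .
      have "norm x < 1"
        unfolding x_def by (rule lt1) (use n(5) in simp)
      moreover have "norm y < 1"
        unfolding y_def by (rule lt1, unfold n(1,3), fact n(4))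
      ultimately have "norm (cnj x * y) \<le> 1"
        by (simp add: norm_mult mult_le_one)
      then show "norm (1 - cnj x * y) \<le> 2"
        using norm_triangle_ineq4[of 1 "cnj x * y"] by simp
    qed auto
    finally have yx: "norm (y - x) \<le> norm z ^ p * 2" .
    have "norm x \<le> norm (of_real a * z ^ p)"
      unfolding x_def
      by (rule Schwarz_Lemma(1)[OF hol0 G0]) (use lt1 n(5) in auto)
    also have "\<dots> \<le> norm z ^ p"
      unfolding n(1) using a by (simp add: mult_left_le_one_le)
    finally have "norm x \<le> norm z ^ p" .
    with yx norm_triangle_ineq[of "y - x" x] show ?thesis
      by (simp add: norm_power y_def)
  qed
  then show "\<forall>\<^sub>F z in at 0. norm (G (of_real a * z ^ p) (of_real (1 - a) * z ^ Suc p)) \<le> 3 * norm (z ^ p)"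
    by (auto simp: eventually_at intro!: exI[of _ 1])
qed simp

lemma slice_not_degree_one:
  fixes G :: "complex \<Rightarrow> complex \<Rightarrow> complex"
  assumes a: "0 < a" "a < 1" and p: "p \<ge> 1"
    and hol0: "(\<lambda>s. G s 0) holomorphic_on ball 0 1" and G0: "G 0 0 = 0"
    and hol: "\<And>s. norm s < 1 \<Longrightarrow> G s holomorphic_on ball 0 (1 - norm s)"
    and lt1: "\<And>s w. norm s + norm w < 1 \<Longrightarrow> norm (G s w) < 1"
    and \<eta>: "norm \<eta> = 1"
    and nz: "\<And>z. norm z < 1 \<Longrightarrow> 1 + cnj q * \<eta> * z \<noteq> 0"
    and eq: "\<And>z. norm z < 1 \<Longrightarrow> G (of_real a * z ^ p) (of_real (1 - a) * z ^ Suc p) =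
        z ^ p * ((q + \<eta> * z) / (1 + cnj q * \<eta> * z))"
  shows False
proof -
  obtain u where holu: "u holomorphic_on ball 0 1"
    and gu: "\<And>z. norm z < 1 \<Longrightarrow> G z 0 = z * u z" and u1: "\<And>z. norm z < 1 \<Longrightarrow> norm (u z) \<le> 1"
    by (rule Schwarz_quotient[OF hol0 G0]) (use lt1 in auto)
  define Q where "Q z = (q + \<eta> * z) / (1 + cnj q * \<eta> * z)" for z
  define x where "x z = of_real a * z ^ p * u (of_real a * z ^ p)" for z
  \<comment> \<open>\<open>K\<close> is chosen so that the slice estimate reads
    \<open>norm z ^ p * (norm z * K z)\<close>; it tends to \<open>1 - a\<close>.\<close>
  define K where "K z = norm (1 - cnj (x z) * (z ^ p * Q z)) * (1 - a) / (1 - a * norm z ^ p)" for z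
  have u_lim: "(\<lambda>z. u (of_real a * z ^ p)) \<midarrow>0\<rightarrow> u 0"
  proof (rule isCont_tendsto_compose[of 0 u])
    show "isCont u 0"
      using holomorphic_on_imp_continuous_on[OF holu] by (simp add: continuous_on_eq_continuous_at)
    show "(\<lambda>z. of_real a * z ^ p :: complex) \<midarrow>0\<rightarrow> 0"
      using p by (auto intro!: tendsto_eq_intros)
  qed
  have x_lim: "x \<midarrow>0\<rightarrow> 0"
    unfolding x_def using p by (auto intro!: tendsto_eq_intros u_lim)
  have Q_lim: "Q \<midarrow>0\<rightarrow> q"
    unfolding Q_def by (auto intro!: tendsto_eq_intros)
  have K_lim: "K \<midarrow>0\<rightarrow> 1 - a"
    unfolding K_def using p by (auto intro!: tendsto_eq_intros x_lim Q_lim simp: power_0_left)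
  have near: "eventually (\<lambda>z::complex. norm z < 1 \<and> z \<noteq> 0) (at 0)"
    by (auto simp: eventually_at intro!: exI[of _ 1])

  have est: "norm (Q z - of_real a * u (of_real a * z ^ p)) \<le> norm z * K z"
    if z: "norm z < 1" "z \<noteq> 0" for z
  proof -
    note n = norm_ellipsoid_disc[OF a p z(1)]
    have xz: "G (of_real a * z ^ p) 0 = x z"
      unfolding x_def by (rule gu[OF n(5)])
    have "norm (z ^ p * Q z - x z)
        \<le> (1 - a) * norm z ^ Suc p / (1 - a * norm z ^ p) * norm (1 - cnj (x z) * (z ^ p * Q z))"
      using norm_diff_slice_le[OF a p hol lt1 z(1)] unfolding xz eq[OF z(1)] Q_def .
    also have "\<dots> = norm z ^ p * (norm z * K z)"
      by (simp add: K_def)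
    also have "z ^ p * Q z - x z = z ^ p * (Q z - of_real a * u (of_real a * z ^ p))"
      by (simp add: x_def algebra_simps)
    finally show ?thesis
      using z by (simp add: norm_mult norm_power)
  qed
  \<comment> \<open>The value of \<open>Q\<close> at 0 comes from letting \<open>z\<close> tend to 0
    in \<open>est\<close>.\<close>
  have q: "q = of_real a * u 0"
  proof -
    have "(\<lambda>z. norm z * K z) \<midarrow>0\<rightarrow> 0"
      by (auto intro!: tendsto_eq_intros K_lim)
    then have "(\<lambda>z. Q z - of_real a * u (of_real a * z ^ p)) \<midarrow>0\<rightarrow> 0"
      by (rule Lim_null_comparison[rotated]) (use near est in \<open>auto elim!: eventually_mono\<close>)
    moreover have "(\<lambda>z. Q z - of_real a * u (of_real a * z ^ p)) \<midarrow>0\<rightarrow> q - of_real a * u 0"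
      by (intro tendsto_intros Q_lim u_lim)
    ultimately show ?thesis
      using LIM_unique by fastforce
  qed

  text \<open>\<open>L z = \<bar>Q z - q\<bar> / \<bar>z\<bar>\<close>, with the cancelled form also defined at \<open>0\<close>.\<close>
  define L where "L z = \<bar>1 - (norm q)\<^sup>2\<bar> / norm (1 + cnj q * \<eta> * z)" for z
  \<comment> \<open>\<open>U\<close> bounds the same quotient from above: its first term is the
    variation of \<open>a * u\<close> by Schwarz-Pick, its second the slice error, both divided by
    \<open>norm z\<close>.\<close>
  define U where "U z = a\<^sup>2 * norm (1 - cnj (u 0) * u (of_real a * z ^ p)) + K z" for z
  have LU: "L z \<le> U z" if z: "norm z < 1" "z \<noteq> 0" for z
  proof -
    note n = norm_ellipsoid_disc[OF a p z(1)]
    have "Q z - q = \<eta> * z * of_real (1 - (norm q)\<^sup>2) / (1 + cnj q * \<eta> * z)"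
      unfolding of_real_diff of_real_1 complex_norm_square
      using nz[OF z(1)] by (simp add: Q_def field_simps)
    then have "norm z * L z = norm (Q z - q)"
      using \<eta> by (simp add: L_def norm_divide norm_mult del: of_real_diff)
    also have "\<dots> \<le> norm z * K z + norm (of_real a * u (of_real a * z ^ p) - of_real a * u 0)"
      using norm_triangle_ineq[of "Q z - of_real a * u (of_real a * z ^ p)"
          "of_real a * u (of_real a * z ^ p) - of_real a * u 0"] est[OF z] by (simp add: q)
    also have "norm (of_real a * u (of_real a * z ^ p) - of_real a * u 0)
        = a * norm (u (of_real a * z ^ p) - u 0)"
      using a by (simp add: norm_mult flip: right_diff_distrib)
    also have "norm (u (of_real a * z ^ p) - u 0)
        \<le> norm (of_real a * z ^ p) * norm (1 - cnj (u 0) * u (of_real a * z ^ p))"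
      by (rule Schwarz_Pick_at_0[OF holu u1]) (use n(5) in auto)
    also have "\<dots> \<le> (a * norm z) * norm (1 - cnj (u 0) * u (of_real a * z ^ p))"
    proof (rule mult_right_mono)
      \<comment> \<open>This term is of first order only for \<open>p = 1\<close>; the crude bound
        treats all \<open>p \<ge> 1\<close> alike.\<close>
      have "norm z ^ p \<le> norm z ^ 1"
        using z p by (intro power_decreasing) auto
      then show "norm (of_real a * z ^ p) \<le> a * norm z"
        unfolding n(1) using a by simp
    qed simp
    finally have "norm z * L z \<le> norm z * U z"
      using a by (simp add: U_def algebra_simps power2_eq_square)
    then show ?thesis
      using z by simp
  qed
  have L_lim: "L \<midarrow>0\<rightarrow> \<bar>1 - (norm q)\<^sup>2\<bar>"
    unfolding L_def by (auto intro!: tendsto_eq_intros)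
  have "norm (1 - cnj (u 0) * u 0) = 1 - (norm (u 0))\<^sup>2"
  proof -
    have "1 - cnj (u 0) * u 0 = of_real (1 - (norm (u 0))\<^sup>2)"
      by (simp only: of_real_diff of_real_1 complex_norm_square mult.commute)
    moreover have "(norm (u 0))\<^sup>2 \<le> 1"
      using u1[of 0] by (simp add: power_le_one)
    ultimately show ?thesis
      by (simp del: of_real_diff)
  qed
  then have U_lim: "U \<midarrow>0\<rightarrow> a\<^sup>2 * (1 - (norm (u 0))\<^sup>2) + (1 - a)"
    unfolding U_def by (auto intro!: tendsto_eq_intros u_lim K_lim)
  have "\<bar>1 - (norm q)\<^sup>2\<bar> \<le> a\<^sup>2 * (1 - (norm (u 0))\<^sup>2) + (1 - a)"
    by (rule tendsto_le[OF _ U_lim L_lim]) (use near LU in \<open>auto elim!: eventually_mono\<close>)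
  \<comment> \<open>With this value the terms in \<open>u 0\<close> cancel from the inequality,
    leaving \<open>1 \<le> a\<^sup>2 + (1 - a)\<close>.\<close>
  moreover have "(norm q)\<^sup>2 = a\<^sup>2 * (norm (u 0))\<^sup>2"
    using a by (simp add: q norm_mult power_mult_distrib)
  ultimately have "a \<le> a\<^sup>2"
    by (simp add: algebra_simps abs_le_iff)
  then show False
    using a by (simp add: power2_eq_square)
qed

section \<open>From several variables to slices, and the two claims\<close>

text \<open>Complex linearity turns the chain rule derivative \<open>F' (h *s v)\<close> into
  \<open>h * F' v\<close>, so \<open>F' v\<close> is a complex derivative.\<close>

lemma holomorphic_function_on_line:
  fixes F :: "complex ^ 'n \<Rightarrow> complex"
  assumes F: "holomorphic_function_on F D" and S: "\<And>w. w \<in> S \<Longrightarrow> x + w *s v \<in> D"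
  shows "(\<lambda>w. F (x + w *s v)) holomorphic_on S"
  unfolding holomorphic_on_def field_differentiable_def
proof
  fix w assume "w \<in> S"
  then obtain F' where F': "(F has_derivative F') (at (x + w *s v))"
    and lin: "\<And>c v. F' (c *s v) = c * F' v"
    using F S unfolding holomorphic_function_on_def by blast
  have "linear (\<lambda>h. h *s v)"
    by (rule linearI) (simp_all add: vec_eq_iff algebra_simps)
  then have "bounded_linear (\<lambda>h. h *s v)"
    by (rule linear_conv_bounded_linear[THEN iffD1])
  then have "((\<lambda>w. x + w *s v) has_derivative (\<lambda>h. h *s v)) (at w within S)"
    using has_derivative_add[OF has_derivative_const bounded_linear.has_derivative[OF _ has_derivative_ident]]
    by fastforce
  from has_derivative_compose[OF this F']
  have "((\<lambda>w. F (x + w *s v)) has_field_derivative F' v) (at w within S)"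
    by (simp add: has_field_derivative_def lin mult.commute[of _ "F' v"])
  then show "\<exists>f'. ((\<lambda>w. F (x + w *s v)) has_field_derivative f') (at w within S)" ..
qed

text \<open>The coordinate sum maps the ellipsoid into the disc by the triangle inequality, and
  \<open>f\<close> to \<open>z ^ k\<close>, the Blaschke product with all \<open>k\<close> zeros at
  0.\<close>

lemma sum_coords_l_geodesic:
  fixes a :: real and f :: "complex \<Rightarrow> complex ^ 2"
  assumes a: "0 < a" "a < 1" and k: "k \<ge> 1"
    and f: "\<And>z. z \<in> ball 0 1 \<Longrightarrow> f z = vector [of_real a * z ^ k, of_real (1 - a) * z ^ k]"
  shows "l_geodesic (Suc k) ellipsoid f"
  unfolding l_geodesic_def
proof (intro conjI exI)
  let ?F = "\<lambda>v :: complex ^ 2. v $ 1 + v $ 2"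
  have Ff: "?F (f z) = z ^ k" if "z \<in> ball 0 1" for z
    by (simp add: f[OF that] vector_2 algebra_simps)
  show "holomorphic_disc_in f ellipsoid"
    unfolding holomorphic_disc_in_def
  proof (intro conjI allI image_subsetI)
    fix i :: 2
    have "(\<lambda>z. (vector [of_real a * z ^ k, of_real (1 - a) * z ^ k] :: complex ^ 2) $ i)
        holomorphic_on ball 0 1"
      using exhaust_2[of i] by (auto intro!: holomorphic_intros simp: vector_2)
    then show "(\<lambda>z. f z $ i) holomorphic_on ball 0 1"
      by (rule holomorphic_transform) (simp add: f)
  next
    fix z :: complex assume z: "z \<in> ball 0 1"
    then have "norm z ^ k < 1"
      using k by (intro power_less_one_iff[THEN iffD2]) auto
    moreover have "norm (of_real a * z ^ k) + norm (of_real (1 - a) * z ^ k) = norm z ^ k"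
      using a by (simp add: norm_mult norm_power algebra_simps del: of_real_diff)
    ultimately show "f z \<in> ellipsoid"
      unfolding f[OF z] ellipsoid_def mem_Collect_eq vector_2 by linarith
  qed
  have "bounded_linear ?F"
    by (intro bounded_linear_add bounded_linear_vec_nth)
  then have "(?F has_derivative ?F) (at x)" for x
    by (rule bounded_linear.has_derivative) (rule has_derivative_ident)
  then show "holomorphic_function_on ?F ellipsoid"
    unfolding holomorphic_function_on_def by (auto simp: algebra_simps intro!: exI[of _ ?F])
  show "?F ` ellipsoid \<subseteq> ball 0 1"
    by (auto simp: ellipsoid_def intro: norm_triangle_lt)
  show "\<not> (?F \<circ> f) constant_on ball 0 1"
  proof
    assume "(?F \<circ> f) constant_on ball 0 1"
    then have "(?F \<circ> f) (1/2) = (?F \<circ> f) 0"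
      by (force simp: constant_on_def)
    then show False
      using Ff[of "1/2"] Ff[of 0] k by (simp add: zero_power)
  qed
  show "k \<le> Suc k - 1"
    by simp
  show "is_blaschke_product k (?F \<circ> f)"
    unfolding is_blaschke_product_def
    by (rule exI[of _ 1], rule exI[of _ "\<lambda>_. 0"]) (auto simp: Ff[unfolded mem_ball_0] blaschke_factor_def)
qed

lemma not_l_geodesic_ellipsoid:
  fixes a :: real and \<phi> :: "complex \<Rightarrow> complex ^ 2"
  assumes a: "0 < a" "a < 1" and p: "p \<ge> 1"
    and \<phi>: "\<And>z. z \<in> ball 0 1 \<Longrightarrow> \<phi> z = vector [of_real a * z ^ p, of_real (1 - a) * z ^ Suc p]"
  shows "\<not> l_geodesic (Suc (Suc p)) ellipsoid \<phi>"
proof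
  assume "l_geodesic (Suc (Suc p)) ellipsoid \<phi>"
  then obtain F k where F: "holomorphic_function_on F ellipsoid" "F ` ellipsoid \<subseteq> ball 0 1"
    and nonconst: "\<not> (F \<circ> \<phi>) constant_on ball 0 1"
    and k: "k \<le> Suc p" and B: "is_blaschke_product k (F \<circ> \<phi>)"
    and \<phi>E: "\<phi> ` ball 0 1 \<subseteq> ellipsoid"
    unfolding l_geodesic_def holomorphic_disc_in_def by auto
  define V :: "complex \<Rightarrow> complex \<Rightarrow> complex ^ 2" where "V s w = vector [s, w]" for s w
  define \<beta> where "\<beta> = F (V 0 0)"
  define G where "G s w = Moebius_function 0 \<beta> (F (V s w))" for s w
  have VE: "V s w \<in> ellipsoid \<longleftrightarrow> norm s + norm w < 1" for s w
    by (simp add: V_def ellipsoid_def)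
  have FV: "norm (F (V s w)) < 1" if "norm s + norm w < 1" for s w
    using F(2) that by (force simp flip: VE)
  have \<beta>: "norm \<beta> < 1"
    unfolding \<beta>_def by (rule FV) simp
  \<comment> \<open>Writing the slices as complex lines makes
    \<open>holomorphic_function_on_line\<close> applicable to them.\<close>
  have Vline: "V s w = V s 0 + w *s V 0 1" "V s 0 = V 0 0 + s *s V 1 0" for s w
    by (simp_all add: V_def vec_eq_iff forall_2)
  note Mhol = holomorphic_on_compose_gen[OF _ Moebius_function_holomorphic[OF \<beta>], unfolded o_def]
  have hol: "G s holomorphic_on ball 0 (1 - norm s)" for s
    unfolding G_def
  proof (rule Mhol)
    have "(\<lambda>w. F (V s 0 + w *s V 0 1)) holomorphic_on ball 0 (1 - norm s)"
      by (rule holomorphic_function_on_line[OF F(1)]) (simp add: VE flip: Vline(1))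
    then show "(\<lambda>w. F (V s w)) holomorphic_on ball 0 (1 - norm s)"
      by (simp flip: Vline(1))
    show "(\<lambda>w. F (V s w)) ` ball 0 (1 - norm s) \<subseteq> ball 0 1"
      by (auto intro!: FV)
  qed
  have hol0: "(\<lambda>s. G s 0) holomorphic_on ball 0 1"
    unfolding G_def
  proof (rule Mhol)
    have "(\<lambda>s. F (V 0 0 + s *s V 1 0)) holomorphic_on ball 0 1"
      by (rule holomorphic_function_on_line[OF F(1)]) (simp add: VE flip: Vline(2))
    then show "(\<lambda>s. F (V s 0)) holomorphic_on ball 0 1"
      by (simp flip: Vline(2))
    show "(\<lambda>s. F (V s 0)) ` ball 0 1 \<subseteq> ball 0 1"
      by (auto intro!: FV)
  qed
  have G0: "G 0 0 = 0"
    by (simp add: G_def \<beta>_def Moebius_function_eq_zero)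
  have lt1: "norm (G s w) < 1" if "norm s + norm w < 1" for s w
    unfolding G_def by (rule Moebius_function_norm_lt_1[OF \<beta> FV[OF that]])
  let ?y = "\<lambda>z. G (of_real a * z ^ p) (of_real (1 - a) * z ^ Suc p)"
  have B1: "norm ((F \<circ> \<phi>) z) < 1" if "norm z < 1" for z
    using \<phi>E F(2) that by (force simp: image_subset_iff)
  have y: "?y z = ((F \<circ> \<phi>) z - \<beta>) / (1 - cnj \<beta> * (F \<circ> \<phi>) z)" if "norm z < 1" for z
    using \<phi>[of z] that by (simp add: G_def V_def Moebius_function_simple)
  have sub: "(F \<circ> \<phi>) z - \<beta> = (1 - cnj \<beta> * (F \<circ> \<phi>) z) * ?y z" if "norm z < 1" for z
  proof -
    have "norm (cnj \<beta> * (F \<circ> \<phi>) z) < 1"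
      using mult_strict_mono'[OF \<beta> B1[OF that]] by (simp add: norm_mult)
    then have "1 - cnj \<beta> * (F \<circ> \<phi>) z \<noteq> 0"
      by auto
    then show ?thesis
      unfolding y[OF that] by simp
  qed
  have near: "eventually (\<lambda>z::complex. norm z < 1) (at 0)"
    by (auto simp: eventually_at intro!: exI[of _ 1])
  \<comment> \<open>By \<open>sub\<close> the difference is \<open>?y z\<close> times a factor of
    norm at most 2, so the order of vanishing found for \<open>G\<close> passes to
    \<open>F \<circ> \<phi>\<close>.\<close>
  have "(\<lambda>z. (F \<circ> \<phi>) z - \<beta>) \<in> O[at 0](?y)"
  proof (rule landau_o.bigI[where c = 2])
    have "norm ((F \<circ> \<phi>) z - \<beta>) \<le> 2 * norm (?y z)" if z: "norm z < 1" for z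
    proof -
      have "norm (cnj \<beta> * (F \<circ> \<phi>) z) \<le> 1"
        using \<beta> B1[OF z] by (simp add: norm_mult mult_le_one)
      then have "norm (1 - cnj \<beta> * (F \<circ> \<phi>) z) \<le> 2"
        using norm_triangle_ineq4[of 1 "cnj \<beta> * (F \<circ> \<phi>) z"] by simp
      then show ?thesis
        unfolding sub[OF z] norm_mult by (intro mult_right_mono) auto
    qed
    with near show "\<forall>\<^sub>F z in at 0. norm ((F \<circ> \<phi>) z - \<beta>) \<le> 2 * norm (?y z)"
      by (auto elim!: eventually_mono)
  qed simp
  also have "?y \<in> O[at 0](\<lambda>z. z ^ p)"
    by (rule slice_bigo[OF a p hol0 G0 hol lt1])
  finally have bigo: "(\<lambda>z. (F \<circ> \<phi>) z - \<beta>) \<in> O[at 0](\<lambda>z. z ^ p)" .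
  obtain q \<eta> where \<eta>: "norm \<eta> = 1" and nz: "\<And>z. norm z < 1 \<Longrightarrow> 1 + cnj q * \<eta> * z \<noteq> 0"
    and eq: "\<And>z. norm z < 1 \<Longrightarrow> ((F \<circ> \<phi>) z - \<beta>) / (1 - cnj \<beta> * (F \<circ> \<phi>) z)
        = z ^ p * ((q + \<eta> * z) / (1 + cnj q * \<eta> * z))"
    using blaschke_product_recentred[OF B k B1 \<beta> nonconst bigo] by metis
  show False
    by (rule slice_not_degree_one[OF a p hol0 G0 hol lt1 \<eta> nz]) (use y eq in auto)
qed

theorem corollary4p3:
  fixes m :: nat and a :: real and f \<phi> :: "complex \<Rightarrow> complex ^ 2"
  assumes "m \<ge> 4"
    and "0 < a" and "a < 1"
    and "\<And>z. z \<in> ball 0 1 \<Longrightarrow>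
           f z = vector [of_real a * z ^ (m - 1), of_real (1 - a) * z ^ (m - 1)]"
    and "\<And>z. z \<in> ball 0 1 \<Longrightarrow> \<phi> z = vector [f z $ 1 / z ^ 2, f z $ 2 / z]"
  shows "l_geodesic m ellipsoid f \<and> \<not> l_geodesic (m - 1) ellipsoid \<phi>"
proof
  show "l_geodesic m ellipsoid f"
    using sum_coords_l_geodesic[OF assms(2,3) _ assms(4)] assms(1) by simp
  \<comment> \<open>Put \<open>p = m - 3\<close>: an \<open>(m - 1)\<close>-geodesic allows degree
    at most \<open>m - 2\<close>, one more than the exponent \<open>p\<close> of the first
    coordinate of \<open>\<phi>\<close>.\<close>
  have "Suc (m - 3) = m - 2" "Suc (Suc (m - 3)) = m - 1"
    using assms(1) by linarith+
  moreover have "\<phi> z = vector [of_real a * z ^ (m - 3), of_real (1 - a) * z ^ (m - 2)]"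
    if "z \<in> ball 0 1" for z
    unfolding assms(5)[OF that] assms(4)[OF that] vector_2 quotient_disc_eq[OF assms(1)] ..
  ultimately show "\<not> l_geodesic (m - 1) ellipsoid \<phi>"
    using not_l_geodesic_ellipsoid[of a "m - 3" \<phi>] assms(1-3) by simp
qed

end
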